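(* Let $n\ge 1$. Then $$\sum_{\pi\in T_n} q^{\mathrm{ldes}(\pi)}=\sum_{p\in \mathcal{P}_n} q^{\mathrm{ldes}(p)}=\sum_{p\in \mathcal{P}_n} q^{\mathrm{lind}(p)-1}.$$ Moreover, for any $B \subseteq [n-2]$, $$\sum_{\pi\in T_n(B)} q^{\mathrm{ldes}(\pi)} =\sum_{p\in \mathcal{P}_n(B)} q^{\mathrm{ldes}(p)} =\sum_{p\in \mathcal{P}_n(B)} q^{\mathrm{lind}(p)-1},$$ where $$T_n(B):=\{\pi\in T_n \mid \mathrm{Des}(\pi^{-1})\cap [n-2] = B\},\qquad \mathcal{P}_n(B) := \{p\in \mathcal{P}_n \mid \mathrm{Des}(p^{-1}) \cap [n-2] = B\}.$$
   Context: $[m]=\{1,\dots,m\}$ (empty if $m\le 0$), and $q$ is an indeterminate. Permutations: $S_n$ is the symmetric group on $\{1,\dots,n\}$; $T_n$ is the set of $321$-avoiding permutations, i.e. all $\pi\in S_n$ for which there are no $i<j<k$ with $\pi(i)>\pi(j)>\pi(k)$. For $\pi\in T_n$: $\mathrm{ldes}(\pi)=\max\{1\le i\le n-1 \mid \pi(i)>\pi(i+1)\}$, with $\mathrm{ldes}(\mathrm{id}):=0$; $\mathrm{Des}(\pi^{-1})=\{1\le i\le n-1\mid \pi^{-1}(i)>\pi^{-1}(i+1)\}$. Dyck paths: $\mathcal{P}_n$ is the set of Dyck paths of length $2n$, i.e. sequences $p=(p_1,\dots,p_{2n})$ of $n$ entries $+1$ and $n$ entries $-1$ such that $p_1+\dots+p_i\ge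 0$ for all $i$. For $p\in\mathcal{P}_n$: $\mathrm{ldes}(p)=\max\{1\le i\le n-1\mid p_i=+1,\ p_{i+1}=-1\}$, with $\mathrm{ldes}(p):=0$ if $p=(+1,\dots,+1,-1,\dots,-1)$ (when this set is empty); $\mathrm{lind}(p)=\max\{1\le i\le n\mid p_i=+1,\ p_{i+1}=-1\}$; $\mathrm{Des}(p^{-1})=\{1\le i\le n-1\mid p_{2n-i}=+1,\ p_{2n-i+1}=-1\}$. *)

theory Defs
  imports "HOL-Combinatorics.Permutations" "HOL-Computational_Algebra.Polynomial"
begin

definition avoids_321 :: "nat \<Rightarrow> (nat \<Rightarrow> nat) \<Rightarrow> bool" where
  "avoids_321 n \<pi> \<longleftrightarrow>
     \<not> (\<exists>i\<in>{1..n}. \<exists>j\<in>{1..n}. \<exists>k\<in>{1..n}. i < j \<and> j < k \<and> \<pi> i > \<pi> j \<and> \<pi> j > \<pi> k)"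

definition T :: "nat \<Rightarrow> (nat \<Rightarrow> nat) set" where
  "T n = {\<pi>. \<pi> permutes {1..n} \<and> avoids_321 n \<pi>}"

definition perm_Des :: "nat \<Rightarrow> (nat \<Rightarrow> nat) \<Rightarrow> nat set" where
  "perm_Des n \<pi> = {i \<in> {1..n-1}. \<pi> i > \<pi> (i + 1)}"

definition perm_ldes :: "nat \<Rightarrow> (nat \<Rightarrow> nat) \<Rightarrow> nat" where
  "perm_ldes n \<pi> = (if \<pi> = id then 0 else Max (perm_Des n \<pi>))"

definition dyck_paths :: "nat \<Rightarrow> int list set" where
  "dyck_paths n = {p. length p = 2 * n \<and> count_list p 1 = n \<and> count_list p (-1) = n \<and>
     (\<forall>i\<in>{1..2*n}. sum_list (take i p) \<ge> 0)}"

text \<open>Path entries are numbered from 1, list entries from 0.\<close>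

definition path_entry :: "int list \<Rightarrow> nat \<Rightarrow> int" where
  "path_entry p i = p ! (i - 1)"

definition peak_at :: "int list \<Rightarrow> nat \<Rightarrow> bool" where
  "peak_at p i \<longleftrightarrow> path_entry p i = 1 \<and> path_entry p (i + 1) = -1"

text \<open>The set is empty exactly for the path of \<open>n\<close> up-steps followed by \<open>n\<close> down-steps.\<close>

definition path_ldes :: "nat \<Rightarrow> int list \<Rightarrow> nat" where
  "path_ldes n p = (let D = {i \<in> {1..n-1}. peak_at p i} in if D = {} then 0 else Max D)"

text \<open>For \<open>n \<ge> 1\<close> the first peak of a Dyck path of length \<open>2 * n\<close> occurs at some position
  in \<open>{1..n}\<close>, so the maximum below is over a nonempty set and is at least 1.\<close>

definition path_lind :: "nat \<Rightarrow> int list \<Rightarrow> nat" where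
  "path_lind n p = Max {i \<in> {1..n}. peak_at p i}"

text \<open>\<open>Des (p\<^sup>-\<^sup>1)\<close> for a path \<open>p\<close> is a single piece of notation; no inverse path is involved.\<close>

definition path_inv_Des :: "nat \<Rightarrow> int list \<Rightarrow> nat set" where
  "path_inv_Des n p = {i \<in> {1..n-1}. peak_at p (2 * n - i)}"

text \<open>For \<open>n \<le> 2\<close>, \<open>{1..n-2}\<close> is empty, since subtraction on \<open>nat\<close> truncates at 0.\<close>

definition T_B :: "nat \<Rightarrow> nat set \<Rightarrow> (nat \<Rightarrow> nat) set" where
  "T_B n B = {\<pi> \<in> T n. perm_Des n (inv \<pi>) \<inter> {1..n-2} = B}"

definition dyck_paths_B :: "nat \<Rightarrow> nat set \<Rightarrow> int list set" where
  "dyck_paths_B n B = {p \<in> dyck_paths n. path_inv_Des n p \<inter> {1..n-2} = B}"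

abbreviation q :: "int poly" where
  "q \<equiv> [:0, 1:]"

end

theory Submission imports Defs begin

text \<open>
  Cut a Dyck path of length \<open>2 n\<close> in the middle and read its second half backwards, with all
  steps reversed. The result is a pair \<open>(P, Q)\<close> of nonnegative paths of length \<open>n\<close> with a common
  final height, where \<open>Q\<close> is the first half. The peaks of \<open>P\<close> are the inverse descents of the
  Dyck path, and the last peak of \<open>Q\<close> is its \<open>ldes\<close>. (For 321-avoiding permutations, \<open>P\<close> and \<open>Q\<close>
  play the roles of the two tableaux of the Robinson-Schensted correspondence.)

  Permutations and Dyck paths are compared by growing both with the same succession rule.
  Give an object of size \<open>n\<close> the label \<open>(D, l, e)\<close>, where \<open>D\<close> is the set of inverse descents,
  \<open>l\<close> is the last descent, and \<open>e\<close> says that \<open>\<pi> n = n\<close>, or that both \<open>P\<close> and \<open>Q\<close> end in an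
  up-step. Writing the value \<open>n + 1\<close> right after the first \<open>k\<close> entries of \<open>\<pi>\<close> avoids the pattern
  321 exactly if the later entries increase, that is, if \<open>l \<le> k\<close>. The new last descent is
  \<open>k + 1\<close>, or still \<open>l\<close> if \<open>k = n\<close>; the number \<open>n\<close> becomes an inverse descent exactly if \<open>e\<close> holds
  and \<open>k < n\<close>. A pair of paths has children for the same \<open>k\<close>: both paths are prolonged by an
  up-step if \<open>k = n\<close>; otherwise \<open>Q\<close> is \<open>w\<close> followed by \<open>a\<close> down-steps and \<open>b\<close> up-steps, with \<open>w\<close> of
  length \<open>k\<close>, and an up-step is inserted after \<open>w\<close> while the first of the \<open>b\<close> up-steps (if there
  is one) turns into a down-step; the last step of \<open>P\<close> restores the common height. Each object of size
  \<open>n + 1\<close> is the child of exactly one object for one \<open>k\<close>, and labels change by the same rule in both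
  families, so the labels are equidistributed (\<open>sum_label_eq_tree_sum\<close>). This gives
  the first equality, even with the full sets of inverse descents.

  For the second equality the Dyck path is cut after \<open>n + 1\<close> steps instead. The shorter half has
  \<open>n - 1\<close> steps, and its peaks are the inverse descents in \<open>{1..n-2}\<close>; it stays fixed. The longer
  half \<open>u\<close> runs through the paths of length \<open>n + 1\<close> with a given final height, and these are
  permuted by a map \<open>\<phi>\<close> such that the last peak of \<open>\<phi> u\<close> is one more than the last peak of \<open>u\<close> without
  its last step (\<open>lift_last_peak_correct\<close>). Essentially \<open>\<phi>\<close> moves the last step of the path to the
  position just before the last of the earlier peaks.
\<close>

section \<open>Nonnegative lattice paths and their peaks\<close>

definition nonneg_path :: "int list \<Rightarrow> bool" where
  "nonneg_path xs \<longleftrightarrow> set xs \<subseteq> {1, -1} \<and> (\<forall>i. 0 \<le> sum_list (take i xs))"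

definition peaks :: "int list \<Rightarrow> nat set" where
  "peaks xs = {i. 1 \<le> i \<and> i < length xs \<and> peak_at xs i}"

definition last_peak :: "int list \<Rightarrow> nat" where
  "last_peak xs = Max (insert 0 (peaks xs))"

text \<open>What follows the last peak of a path: a fall, then a rise; either may be empty.\<close>

definition valley :: "nat \<Rightarrow> nat \<Rightarrow> int list" where
  "valley a b = replicate a (-1) @ replicate b 1"

lemma nonneg_path_Nil [simp]: "nonneg_path []"
  by (simp add: nonneg_path_def)

lemma nonneg_path_snoc:
  "nonneg_path (xs @ [x]) \<longleftrightarrow> nonneg_path xs \<and> (x = 1 \<or> x = -1) \<and> 0 \<le> sum_list xs + x"
proof
  assume h: "nonneg_path (xs @ [x])"
  have "0 \<le> sum_list (take i xs)" for i
    using h[unfolded nonneg_path_def, THEN conjunct2, rule_format, of "min i (length xs)"]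
    by (cases "i \<le> length xs") auto
  moreover have "0 \<le> sum_list xs + x"
    using h[unfolded nonneg_path_def, THEN conjunct2, rule_format, of "Suc (length xs)"] by simp
  ultimately show "nonneg_path xs \<and> (x = 1 \<or> x = -1) \<and> 0 \<le> sum_list xs + x"
    using h by (auto simp: nonneg_path_def)
next
  assume h: "nonneg_path xs \<and> (x = 1 \<or> x = -1) \<and> 0 \<le> sum_list xs + x"
  have "0 \<le> sum_list (take i (xs @ [x]))" for i
    using h by (cases "i \<le> length xs") (auto simp: nonneg_path_def)
  then show "nonneg_path (xs @ [x])" using h by (auto simp: nonneg_path_def)
qed

lemma nonneg_path_sum_nonneg: "nonneg_path xs \<Longrightarrow> 0 \<le> sum_list xs"
  unfolding nonneg_path_def by (metis order_refl take_all_iff)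

lemma nonneg_path_append_downs:
  "nonneg_path (xs @ replicate a (-1)) \<longleftrightarrow> nonneg_path xs \<and> int a \<le> sum_list xs"
proof (induction a)
  case 0
  then show ?case using nonneg_path_sum_nonneg by auto
next
  case (Suc a)
  have "nonneg_path (xs @ replicate (Suc a) (-1)) \<longleftrightarrow> nonneg_path ((xs @ replicate a (-1)) @ [-1])"
    by (simp add: replicate_append_same)
  also have "\<dots> \<longleftrightarrow> nonneg_path xs \<and> int (Suc a) \<le> sum_list xs"
    unfolding nonneg_path_snoc Suc.IH by (auto simp: sum_list_replicate)
  finally show ?case .
qed

lemma nonneg_path_append_ups: "nonneg_path (xs @ replicate b 1) \<longleftrightarrow> nonneg_path xs"
proof (induction b)
  case (Suc b)
  have "nonneg_path (xs @ replicate (Suc b) 1) \<longleftrightarrow> nonneg_path ((xs @ replicate b 1) @ [1])"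
    by (simp add: replicate_append_same)
  also have "\<dots> \<longleftrightarrow> nonneg_path xs"
    unfolding nonneg_path_snoc Suc.IH using nonneg_path_sum_nonneg[of xs]
    by (auto simp: sum_list_replicate)
  finally show ?case .
qed simp

text \<open>Only the lowest point of the valley can violate nonnegativity.\<close>

lemma nonneg_path_append_valley:
  "nonneg_path (xs @ valley a b) \<longleftrightarrow> nonneg_path xs \<and> int a \<le> sum_list xs"
  unfolding valley_def append_assoc[symmetric] nonneg_path_append_ups nonneg_path_append_downs ..

lemma nonneg_path_append_peak_valley:
  "nonneg_path (xs @ 1 # valley a b) \<longleftrightarrow> nonneg_path xs \<and> int a \<le> sum_list xs + 1"
  using nonneg_path_append_valley[of "xs @ [1]" a b] nonneg_path_sum_nonneg[of xs]
  by (auto simp: nonneg_path_snoc)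

lemma count_list_replicate: "count_list (replicate n x) y = (if x = y then n else 0)"
  by (induction n) auto

lemma length_valley [simp]: "length (valley a b) = a + b"
  and sum_list_valley [simp]: "sum_list (valley a b) = int b - int a"
  and count_list_valley [simp]: "count_list (valley a b) (-1) = a"
  by (simp_all add: valley_def sum_list_replicate count_list_replicate)

lemma valley_0_0 [simp]: "valley 0 0 = []"
  by (simp add: valley_def)

lemma finite_peaks [simp]: "finite (peaks xs)"
  by (rule finite_subset[of _ "{..length xs}"]) (auto simp: peaks_def)

lemma last_peak_le_iff: "last_peak xs \<le> k \<longleftrightarrow> (\<forall>i\<in>peaks xs. i \<le> k)"
  by (simp add: last_peak_def)

lemma peaks_snoc:
  "peaks (xs @ [x]) = peaks xs \<union> (if xs \<noteq> [] \<and> last xs = 1 \<and> x = -1 then {length xs} else {})"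
proof -
  have "i \<in> peaks (xs @ [x]) \<longleftrightarrow>
      i \<in> peaks xs \<or> i = length xs \<and> xs \<noteq> [] \<and> last xs = 1 \<and> x = -1" for i
  proof (cases "i < length xs")
    case True
    then show ?thesis by (auto simp: peaks_def peak_at_def path_entry_def nth_append)
  next
    case False
    then show ?thesis
      by (cases "i = length xs")
         (auto simp: peaks_def peak_at_def path_entry_def nth_append last_conv_nth Suc_le_eq)
  qed
  then show ?thesis by auto
qed

lemma last_peak_snoc_up: "last_peak (xs @ [1]) = last_peak xs"
  by (simp add: last_peak_def peaks_snoc)

lemma peaks_append_ups: "peaks (xs @ replicate b 1) = peaks xs"
proof (induction b)
  case (Suc b)
  have "xs @ replicate (Suc b) 1 = (xs @ replicate b 1) @ [1]"
    by (simp add: replicate_append_same)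
  then show ?case using Suc.IH by (simp only: peaks_snoc) simp
qed simp

lemma peaks_append_downs:
  "peaks (xs @ replicate a (-1)) =
     peaks xs \<union> (if 0 < a \<and> xs \<noteq> [] \<and> last xs = 1 then {length xs} else {})"
proof (induction a)
  case (Suc a)
  have "xs @ replicate (Suc a) (-1) = (xs @ replicate a (-1)) @ [-1]"
    by (simp add: replicate_append_same)
  then have "peaks (xs @ replicate (Suc a) (-1)) = peaks xs \<union>
      (if 0 < a \<and> xs \<noteq> [] \<and> last xs = 1 then {length xs} else {}) \<union>
      (if xs @ replicate a (-1) \<noteq> [] \<and> last (xs @ replicate a (-1)) = 1
       then {length xs + a} else {})"
    using Suc.IH by (simp only: peaks_snoc) simp
  then show ?case by (cases a) auto
qed simp

lemma peaks_append_valley: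
  "peaks (xs @ valley a b) =
     peaks xs \<union> (if 0 < a \<and> xs \<noteq> [] \<and> last xs = 1 then {length xs} else {})"
  unfolding valley_def append_assoc[symmetric] peaks_append_ups peaks_append_downs ..

lemma last_peak_append_valley_le: "last_peak (xs @ valley a b) \<le> length xs"
  unfolding last_peak_le_iff peaks_append_valley by (auto simp: peaks_def)

lemma last_peak_append_peak_valley:
  assumes "0 < a" shows "last_peak (xs @ 1 # valley a b) = Suc (length xs)"
proof -
  have "peaks (xs @ 1 # valley a b) = peaks (xs @ [1]) \<union> {Suc (length xs)}"
    using assms peaks_append_valley[of "xs @ [1]" a b] by simp
  moreover have "\<forall>i\<in>peaks (xs @ [1]). i \<le> Suc (length xs)" by (auto simp: peaks_def)
  ultimately show ?thesis unfolding last_peak_def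
    by (intro Max_eqI) auto
qed

lemma last_peak_ups [simp]: "last_peak (replicate b 1) = 0"
proof -
  have "peaks (replicate b 1) = {}" using peaks_append_ups[of "[]" b] by (simp add: peaks_def)
  then show ?thesis by (simp add: last_peak_def)
qed

text \<open>A down-step that is preceded by an up-step behind position \<open>k\<close> would be a later peak.\<close>

lemma drop_eq_valley:
  assumes "set xs \<subseteq> {1, -1}" "last_peak xs \<le> k"
  shows "\<exists>a b. drop k xs = valley a b"
  using assms
proof (induction xs rule: rev_induct)
  case Nil
  show ?case by (rule exI[of _ 0], rule exI[of _ 0]) (simp add: valley_def)
next
  case (snoc x xs)
  have "last_peak xs \<le> k" using snoc.prems(2) by (auto simp: last_peak_le_iff peaks_snoc)
  then obtain a b where ab: "drop k xs = valley a b" using snoc.IH snoc.prems(1) by auto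
  show ?case
  proof (cases "length xs < k")
    case True
    then show ?thesis by (intro exI[of _ 0]) (auto simp: valley_def)
  next
    case False
    then have d: "drop k (xs @ [x]) = valley a b @ [x]" using ab by simp
    consider "x = 1" | "x = -1" "b = 0" | "x = -1" "0 < b" using snoc.prems(1) by auto
    then show ?thesis
    proof cases
      case 1
      then have "drop k (xs @ [x]) = valley a (Suc b)"
        using d by (simp add: valley_def replicate_append_same)
      then show ?thesis by blast
    next
      case 2
      then have "drop k (xs @ [x]) = valley (Suc a) 0"
        using d by (simp add: valley_def replicate_append_same)
      then show ?thesis by blast
    next
      case 3
      \<comment> \<open>A fall after a rise would be a peak beyond \<open>k\<close>.\<close>
      have ne: "drop k xs \<noteq> []" using ab 3 by (simp add: valley_def)
      then have "last xs = last (drop k xs)" by (simp add: last_drop)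
      also have "\<dots> = 1" using ab 3 by (simp add: valley_def)
      finally have "length xs \<in> peaks (xs @ [x])" using 3 ne by (auto simp: peaks_snoc)
      then have "length xs \<le> k" using snoc.prems(2) by (auto simp: last_peak_le_iff)
      then show ?thesis using ne by simp
    qed
  qed
qed

text \<open>The normal form by the last peak. A path without peaks consists of up-steps only, because a
  nonnegative path cannot start by falling.\<close>

lemma nonneg_path_cases [consumes 1, case_names ups peak]:
  assumes "nonneg_path xs"
  obtains (ups) "xs = replicate (length xs) 1"
    | (peak) w a b where "xs = w @ 1 # valley a b" "0 < a" "length w = last_peak xs - 1"
proof (cases "last_peak xs = 0")
  case True
  have s: "set xs \<subseteq> {1, -1}" using assms by (simp add: nonneg_path_def)
  obtain a b where ab: "xs = valley a b" using drop_eq_valley[OF s, of 0] True by auto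
  then have "a = 0" using nonneg_path_append_valley[of "[]" a b] assms by simp
  then show ?thesis using ab ups by (simp add: valley_def)
next
  case False
  let ?l = "last_peak xs"
  have s: "set xs \<subseteq> {1, -1}" using assms by (simp add: nonneg_path_def)
  have "?l \<in> insert 0 (peaks xs)" unfolding last_peak_def by (rule Max_in) auto
  then have l: "?l \<in> peaks xs" using False by simp
  then have ll: "?l < length xs" "xs ! (?l - 1) = 1" "xs ! ?l = -1" "1 \<le> ?l"
    by (auto simp: peaks_def peak_at_def path_entry_def)
  obtain a b where ab: "drop ?l xs = valley a b" using drop_eq_valley[OF s order_refl] by blast
  have "valley a b ! 0 = -1" using ab ll by (metis add.right_neutral less_imp_le nth_drop)
  moreover have "a + b > 0" using ab ll by (metis length_drop length_valley zero_less_diff)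
  ultimately have "0 < a" by (cases a) (auto simp: valley_def)
  moreover have "xs = take (?l - 1) xs @ 1 # valley a b"
    using ab ll id_take_nth_drop[of "?l - 1" xs] by simp
  moreover have "length (take (?l - 1) xs) = ?l - 1" using ll by simp
  ultimately show ?thesis using peak by blast
qed


section \<open>Dyck paths as pairs of paths\<close>

lemma sum_list_ups: "xs = replicate (length xs) (1 :: int) \<Longrightarrow> sum_list xs = int (length xs)"
  by (drule arg_cong[of _ _ sum_list]) (simp add: sum_list_replicate)

lemma nonneg_path_sum_le: "nonneg_path xs \<Longrightarrow> sum_list xs \<le> int (length xs)"
proof -
  have "set xs \<subseteq> {1, -1} \<Longrightarrow> sum_list xs \<le> int (length xs)" for xs :: "int list"
    by (induction xs) auto
  then show "nonneg_path xs \<Longrightarrow> sum_list xs \<le> int (length xs)" by (simp add: nonneg_path_def)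
qed

text \<open>The lengths are kept apart, since a Dyck path of length \<open>2 n\<close> is cut after \<open>n\<close> steps for one
  purpose and after \<open>n + 1\<close> steps for another.\<close>

definition path_pairs :: "nat \<Rightarrow> nat \<Rightarrow> (int list \<times> int list) set" where
  "path_pairs a b = {(P, Q). nonneg_path P \<and> nonneg_path Q \<and> length P = a \<and> length Q = b \<and>
     sum_list P = sum_list Q}"

definition glue :: "int list \<times> int list \<Rightarrow> int list" where
  "glue = (\<lambda>(P, Q). Q @ map uminus (rev P))"

text \<open>Heights of a path that is traversed backwards, measured from its end.\<close>

lemma sum_take_reversed_path:
  fixes xs :: "int list"
  shows "sum_list (take j (map uminus (rev xs))) = sum_list (take (length xs - j) xs) - sum_list xs"
proof -
  have neg: "sum_list (map uminus ys) = - sum_list ys" for ys :: "int list"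
    by (induction ys) auto
  have "sum_list (take j (map uminus (rev xs))) = - sum_list (drop (length xs - j) xs)"
    by (simp add: take_map take_rev neg)
  then show ?thesis by (metis add_diff_cancel_left' append_take_drop_id minus_diff_eq sum_list_append)
qed

lemma nonneg_path_glue:
  assumes "sum_list P = sum_list Q"
  shows "nonneg_path (glue (P, Q)) \<longleftrightarrow> nonneg_path P \<and> nonneg_path Q"
proof -
  have s: "set (map uminus (rev P)) \<subseteq> {1, -1} \<longleftrightarrow> set P \<subseteq> {1, -1}" by force
  have glue_tail: "sum_list (take (length Q + j) (glue (P, Q))) = sum_list (take (length P - j) P)" for j
    using assms sum_take_reversed_path[of j P] by (simp add: glue_def)
  have glue_head: "take i (glue (P, Q)) = take i Q" if "i \<le> length Q" for i
    using that by (simp add: glue_def)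
  show ?thesis
  proof
    assume h: "nonneg_path (glue (P, Q))"
    have pos: "0 \<le> sum_list (take i (glue (P, Q)))" for i using h by (simp add: nonneg_path_def)
    have "0 \<le> sum_list (take j P)" for j
      using pos[of "length Q + (length P - j)"] unfolding glue_tail by (cases "j \<le> length P") auto
    moreover have "0 \<le> sum_list (take j Q)" for j
      using pos[of j] pos[of "length Q"] glue_head[of j] glue_head[of "length Q"]
      by (cases "j \<le> length Q") auto
    ultimately show "nonneg_path P \<and> nonneg_path Q"
      using h s by (auto simp: nonneg_path_def glue_def)
  next
    assume h: "nonneg_path P \<and> nonneg_path Q"
    have "0 \<le> sum_list (take i (glue (P, Q)))" for i
    proof (cases "i \<le> length Q")
      case True
      then show ?thesis using h glue_head by (simp add: nonneg_path_def)
    next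
      case False
      then show ?thesis using h glue_tail[of "i - length Q"] by (simp add: nonneg_path_def)
    qed
    then show "nonneg_path (glue (P, Q))" using h s by (auto simp: nonneg_path_def glue_def)
  qed
qed

lemma dyck_paths_eq:
  "dyck_paths n = {p. nonneg_path p \<and> length p = 2 * n \<and> sum_list p = 0}"
proof -
  have cnt: "count_list p 1 + count_list p (-1) \<le> length p \<and>
      (count_list p 1 + count_list p (-1) = length p \<longleftrightarrow> set p \<subseteq> {1, -1})" for p :: "int list"
    by (induction p) auto
  have sm: "set p \<subseteq> {1, -1} \<Longrightarrow> sum_list p = int (count_list p 1) - int (count_list p (-1))"
    for p :: "int list"
    by (induction p) auto
  have tk: "(\<forall>i\<in>{1..2*n}. sum_list (take i p) \<ge> 0) \<longleftrightarrow> (\<forall>i. sum_list (take i p) \<ge> 0)"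
    if "length p = 2 * n" "sum_list p = 0" for p :: "int list"
  proof
    assume h: "\<forall>i\<in>{1..2*n}. sum_list (take i p) \<ge> 0"
    show "\<forall>i. sum_list (take i p) \<ge> 0"
    proof
      fix i show "sum_list (take i p) \<ge> 0"
        using h that by (cases "i = 0"; cases "i \<le> 2 * n") auto
    qed
  qed auto
  have "p \<in> dyck_paths n \<longleftrightarrow> nonneg_path p \<and> length p = 2 * n \<and> sum_list p = 0" for p
  proof
    assume h: "p \<in> dyck_paths n"
    then have c: "length p = 2 * n" "count_list p 1 = n" "count_list p (-1) = n"
      and t: "\<forall>i\<in>{1..2*n}. sum_list (take i p) \<ge> 0"
      by (auto simp: dyck_paths_def)
    have s: "set p \<subseteq> {1, -1}" using cnt[of p] c by simp
    then have z: "sum_list p = 0" using sm[of p] c by simp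
    show "nonneg_path p \<and> length p = 2 * n \<and> sum_list p = 0"
      using tk[OF c(1) z] s t c z by (simp add: nonneg_path_def)
  next
    assume h: "nonneg_path p \<and> length p = 2 * n \<and> sum_list p = 0"
    then have s: "set p \<subseteq> {1, -1}" by (simp add: nonneg_path_def)
    then have "count_list p 1 = n \<and> count_list p (-1) = n" using sm[OF s] cnt[of p] h by auto
    then show "p \<in> dyck_paths n" using h by (auto simp: dyck_paths_def nonneg_path_def)
  qed
  then show ?thesis by auto
qed

lemma bij_betw_glue:
  assumes "a + b = 2 * n"
  shows "bij_betw glue (path_pairs a b) (dyck_paths n)"
  unfolding bij_betw_def
proof
  show "inj_on glue (path_pairs a b)"
    by (auto simp: inj_on_def path_pairs_def glue_def)
  have neg: "sum_list (map uminus (rev P)) = - sum_list P" for P :: "int list"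
    by (induction P) auto
  show "glue ` path_pairs a b = dyck_paths n"
  proof (intro equalityI subsetI)
    fix p assume "p \<in> glue ` path_pairs a b"
    then obtain P Q where p: "p = glue (P, Q)" "(P, Q) \<in> path_pairs a b" by auto
    then show "p \<in> dyck_paths n"
      using nonneg_path_glue[of P Q] assms neg[of P]
      by (auto simp: dyck_paths_eq path_pairs_def glue_def)
  next
    fix p assume h: "p \<in> dyck_paths n"
    define P Q where "P = map uminus (rev (drop b p))" and "Q = take b p"
    have g: "glue (P, Q) = p" by (simp add: glue_def P_def Q_def rev_map comp_def)
    have "sum_list Q + sum_list (drop b p) = 0"
      using h by (metis (mono_tags, lifting) Q_def append_take_drop_id dyck_paths_eq mem_Collect_eq sum_list_append)
    then have e: "sum_list P = sum_list Q" by (simp only: P_def neg)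
    have "(P, Q) \<in> path_pairs a b"
      using nonneg_path_glue[OF e] g h assms e
      by (auto simp: dyck_paths_eq path_pairs_def P_def Q_def)
    then show "p \<in> glue ` path_pairs a b" using g by force
  qed
qed

lemma peaks_take:
  assumes "m \<le> length p"
  shows "peaks (take m p) = {i \<in> {1..m-1}. peak_at p i}"
  using assms by (auto simp: peaks_def peak_at_def path_entry_def)

lemma path_inv_Des_glue:
  assumes "a + b = 2 * n" "a \<le> n" "(P, Q) \<in> path_pairs a b"
  shows "path_inv_Des n (glue (P, Q)) \<inter> {1..a-1} = peaks P"
proof -
  have l: "length P = a" "length Q = b" using assms by (auto simp: path_pairs_def)
  have "peak_at (glue (P, Q)) (2 * n - i) \<longleftrightarrow> peak_at P i" if "1 \<le> i" "i < a" for i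
  proof -
    have 1: "path_entry (glue (P, Q)) (2 * n - i) = - (P ! i)"
      using that assms l by (auto simp: path_entry_def glue_def nth_append rev_nth
          intro!: arg_cong[of _ _ "(!) P"])
    have 2: "path_entry (glue (P, Q)) (2 * n - i + 1) = - (P ! (i - 1))"
      using that assms l by (auto simp: path_entry_def glue_def nth_append rev_nth
          intro!: arg_cong[of _ _ "(!) P"])
    show ?thesis unfolding peak_at_def 1 2 by (auto simp: path_entry_def)
  qed
  then show ?thesis using l assms(2) by (auto simp: path_inv_Des_def peaks_def)
qed

lemma path_ldes_glue:
  assumes "n \<le> b" "a + b = 2 * n" "(P, Q) \<in> path_pairs a b"
  shows "path_ldes n (glue (P, Q)) = last_peak (take n Q)"
proof -
  have l: "length P = a" "length Q = b" using assms by (auto simp: path_pairs_def)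
  then have "{i \<in> {1..n-1}. peak_at (glue (P, Q)) i} = peaks (take n Q)"
    using peaks_take[of n "glue (P, Q)"] assms by (auto simp: glue_def)
  moreover have "Max (peaks xs) = last_peak xs" if "peaks xs \<noteq> {}" for xs
    using that by (simp add: last_peak_def)
  ultimately show ?thesis
    by (auto simp: path_ldes_def Let_def last_peak_def)
qed

text \<open>There is a peak among the first \<open>n + 1\<close> steps, since the remaining \<open>n - 1\<close> steps cannot
  descend from height \<open>n + 1\<close>. Hence the maximum in \<open>path_lind\<close> is not over the empty set.\<close>

lemma path_lind_glue:
  assumes "(P, Q) \<in> path_pairs (n - 1) (n + 1)" "1 \<le> n"
  shows "path_lind n (glue (P, Q)) = last_peak Q"
proof -
  have l: "length P = n - 1" "length Q = n + 1" and eq: "sum_list P = sum_list Q" "nonneg_path Q"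
    using assms by (auto simp: path_pairs_def)
  have e: "{i \<in> {1..n}. peak_at (glue (P, Q)) i} = peaks Q"
    using peaks_take[of "n + 1" "glue (P, Q)"] l assms by (auto simp: glue_def)
  have "peaks Q \<noteq> {}"
  proof
    assume "peaks Q = {}"
    then have z: "last_peak Q = 0" by (simp add: last_peak_def)
    have "Q = replicate (length Q) 1"
      using eq(2)
    proof (cases rule: nonneg_path_cases)
      case (peak w a b)
      then show ?thesis using z last_peak_append_peak_valley[of a w b] by simp
    qed
    then have "sum_list Q = int n + 1" using l sum_list_ups by auto
    then show False using l eq nonneg_path_sum_le[of P] assms by (auto simp: path_pairs_def)
  qed
  then show ?thesis by (simp add: path_lind_def e[simplified] last_peak_def)
qed

lemma finite_nonneg_paths: "finite {xs. nonneg_path xs \<and> length xs = k}"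
  by (rule finite_subset[OF _ finite_lists_length_eq[of "{1, -1 :: int}" k]])
     (auto simp: nonneg_path_def)

lemma finite_path_pairs: "finite (path_pairs a b)"
  by (rule finite_subset[of _ "{xs. nonneg_path xs \<and> length xs = a} \<times> {xs. nonneg_path xs \<and> length xs = b}"])
     (auto simp: path_pairs_def finite_nonneg_paths)

section \<open>A succession rule\<close>

text \<open>A label \<open>(D, l, e)\<close> holds the inverse descents, the last descent, and a flag which decides whether
  the next step can create an inverse descent.\<close>

type_synonym label = "nat set \<times> nat \<times> bool"

definition successor :: "nat \<Rightarrow> label \<Rightarrow> nat \<Rightarrow> label" where
  "successor n = (\<lambda>(D, l, e) k.
     (if e \<and> k < n then insert n D else D, if k = n then l else k + 1, k = n))"

text \<open>The sum of \<open>F\<close> over the labels in level \<open>n\<close> of the generating tree. The recursion folds the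
  last level into the summand, so that it refers to labels only.\<close>

primrec tree_sum :: "nat \<Rightarrow> (label \<Rightarrow> 'b::comm_monoid_add) \<Rightarrow> 'b" where
  "tree_sum 0 F = F ({}, 0, True)"
| "tree_sum (Suc n) F = tree_sum n (\<lambda>t. \<Sum>k\<in>{fst (snd t)..n}. F (successor n t k))"

text \<open>The label of a child determines \<open>k\<close>: its flag says whether \<open>k = n\<close>, and otherwise its last descent
  is \<open>k + 1\<close>. Hence children for different \<open>k\<close> never coincide, and injectivity has to be
  checked for equal \<open>k\<close> only.\<close>

lemma sum_label_eq_tree_sum:
  fixes A :: "nat \<Rightarrow> 'a set" and label :: "nat \<Rightarrow> 'a \<Rightarrow> label"
    and child :: "nat \<Rightarrow> 'a \<Rightarrow> nat \<Rightarrow> 'a" and F :: "label \<Rightarrow> 'b::comm_monoid_add"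
  assumes finite: "\<And>n. finite (A n)"
    and root: "A 0 = {r}" "label 0 r = ({}, 0, True)"
    and child: "\<And>n x k. x \<in> A n \<Longrightarrow> fst (snd (label n x)) \<le> k \<Longrightarrow> k \<le> n \<Longrightarrow>
        child n x k \<in> A (Suc n) \<and> label (Suc n) (child n x k) = successor n (label n x) k"
    and inj: "\<And>n x y k. x \<in> A n \<Longrightarrow> y \<in> A n \<Longrightarrow> fst (snd (label n x)) \<le> k \<Longrightarrow>
        fst (snd (label n y)) \<le> k \<Longrightarrow> k \<le> n \<Longrightarrow> child n x k = child n y k \<Longrightarrow> x = y"
    and surj: "\<And>n z. z \<in> A (Suc n) \<Longrightarrow>
        \<exists>x\<in>A n. \<exists>k. fst (snd (label n x)) \<le> k \<and> k \<le> n \<and> z = child n x k"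
  shows "(\<Sum>x\<in>A n. F (label n x)) = tree_sum n F"
proof (induction n arbitrary: F)
  case 0
  then show ?case by (simp add: root)
next
  case (Suc n)
  define S where "S = (SIGMA x:A n. {fst (snd (label n x))..n})"
  have "bij_betw (\<lambda>(x, k). child n x k) S (A (Suc n))"
    unfolding bij_betw_def
  proof
    show "inj_on (\<lambda>(x, k). child n x k) S"
    proof (rule inj_onI, clarify)
      fix x j y k
      assume xj: "(x, j) \<in> S" and yk: "(y, k) \<in> S" and eq: "child n x j = child n y k"
      have "successor n (label n x) j = successor n (label n y) k"
        using child[of x n j] child[of y n k] xj yk eq by (auto simp: S_def)
      then have "j = k"
        by (auto simp: successor_def split: prod.splits if_splits)
      then show "x = y \<and> j = k" using inj[of x n y j] xj yk eq by (auto simp: S_def)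
    qed
    show "(\<lambda>(x, k). child n x k) ` S = A (Suc n)"
      using child[of _ n] surj[of _ n] by (force simp: S_def)
  qed
  from sum.reindex_bij_betw[OF this, of "\<lambda>x. F (label (Suc n) x)"]
  have "(\<Sum>x\<in>A (Suc n). F (label (Suc n) x)) =
      (\<Sum>(x, k)\<in>S. F (label (Suc n) (child n x k)))"
    by (simp add: case_prod_unfold)
  also have "\<dots> = (\<Sum>(x, k)\<in>S. F (successor n (label n x) k))"
    using child[of _ n] by (intro sum.cong) (auto simp: S_def)
  also have "\<dots> = (\<Sum>x\<in>A n. \<Sum>k\<in>{fst (snd (label n x))..n}. F (successor n (label n x) k))"
    unfolding S_def by (rule sum.Sigma[symmetric]) (auto simp: finite)
  also have "\<dots> = tree_sum (Suc n) F"
    using Suc.IH[of "\<lambda>t. \<Sum>k\<in>{fst (snd t)..n}. F (successor n t k)"] by simp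
  finally show ?case .
qed

section \<open>Growing pairs of paths\<close>

text \<open>The up-step in front makes the flag true for the empty paths, in accordance with the root label.\<close>

definition pair_label :: "int list \<times> int list \<Rightarrow> label" where
  "pair_label = (\<lambda>(P, Q). (peaks P, last_peak Q, last (1 # P) = 1 \<and> last (1 # Q) = 1))"

text \<open>This is the effect on the two Robinson-Schensted tableaux of inserting a new largest letter at position
  \<open>k + 1\<close> of a permutation. The new letter enters the first row (an up-step) and stays there during
  the \<open>a\<close> bumps that follow; the next letter, which would have been appended, bumps it into the second row.
  If there is no such letter (\<open>b = 0\<close>), it stays in the first row.\<close>

definition pair_child :: "nat \<Rightarrow> int list \<times> int list \<Rightarrow> nat \<Rightarrow> int list \<times> int list" where
  "pair_child n = (\<lambda>(P, Q) k.
     if k = n then (P @ [1], Q @ [1])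
     else let a = count_list (drop k Q) (-1); b = n - k - a in
       if b = 0 then (P @ [1], take k Q @ 1 # valley a 0)
       else (P @ [-1], take k Q @ 1 # valley (a + 1) (b - 1)))"

lemma pair_child_valley:
  assumes "Q = w @ valley a b" "length w = k" "n = k + a + b" "k < n"
  shows "pair_child n (P, Q) k =
    (if b = 0 then (P @ [1], w @ 1 # valley a 0)
     else (P @ [-1], w @ 1 # valley (a + 1) (b - 1)))"
  using assms by (auto simp: pair_child_def)

lemma path_pair_split:
  assumes "(P, Q) \<in> path_pairs n n" "last_peak Q \<le> k" "k < n"
  obtains w a b where "Q = w @ valley a b" "length w = k" "n = k + a + b"
proof -
  have "set Q \<subseteq> {1, -1}" and l: "length Q = n"
    using assms by (auto simp: path_pairs_def nonneg_path_def)
  then obtain a b where ab: "drop k Q = valley a b" using drop_eq_valley assms by blast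
  then have "Q = take k Q @ valley a b" by (metis append_take_drop_id)
  moreover have "n - k = a + b" using arg_cong[OF ab, of length] l by simp
  ultimately show ?thesis using that[of "take k Q" a b] assms l by simp
qed

text \<open>A peak of \<open>P\<close> is created exactly if \<open>P\<close> ended in an up-step and receives a down-step, and the
  latter means \<open>0 < b\<close>, that is, \<open>Q\<close> ended in an up-step. For \<open>k < n\<close> at least one of the new paths ends
  in a down-step: the first one if \<open>0 < b\<close>, the second one if \<open>b = 0\<close>, since then \<open>0 < a\<close>.\<close>

lemma pair_child_correct:
  assumes "(P, Q) \<in> path_pairs n n" "last_peak Q \<le> k" "k \<le> n"
  shows "pair_child n (P, Q) k \<in> path_pairs (Suc n) (Suc n) \<and>
    pair_label (pair_child n (P, Q) k) = successor n (pair_label (P, Q)) k"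
proof (cases "k = n")
  case True
  then show ?thesis using assms nonneg_path_sum_nonneg
    by (auto simp: pair_child_def path_pairs_def nonneg_path_snoc pair_label_def successor_def
        peaks_snoc last_peak_snoc_up)
next
  case False
  then have kn: "k < n" using assms by simp
  then obtain w a b where Q: "Q = w @ valley a b" "length w = k" "n = k + a + b"
    using path_pair_split assms by blast
  have P: "nonneg_path P" "length P = n" "P \<noteq> []" "sum_list P = sum_list w + int b - int a"
    and w: "nonneg_path w" "int a \<le> sum_list w"
    using assms Q kn by (auto simp: path_pairs_def nonneg_path_append_valley)
  show ?thesis
  proof (cases "b = 0")
    case True
    then have a: "0 < a" using Q kn by simp
    have c: "pair_child n (P, Q) k = (P @ [1], w @ 1 # valley a 0)"
      using pair_child_valley[OF Q kn] True by simp
    have "last (1 # Q) \<noteq> 1" "last (1 # w @ 1 # valley a 0) \<noteq> 1"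
      using True a Q by (auto simp: valley_def)
    then show ?thesis
      unfolding c using P w True Q kn a
      by (auto simp: path_pairs_def nonneg_path_snoc nonneg_path_append_peak_valley pair_label_def
          successor_def peaks_snoc last_peak_append_peak_valley)
  next
    case False
    have c: "pair_child n (P, Q) k = (P @ [-1], w @ 1 # valley (a + 1) (b - 1))"
      using pair_child_valley[OF Q kn] False by simp
    have "last (1 # Q) = 1"
      using False Q by (auto simp: valley_def)
    then show ?thesis
      unfolding c using P w False Q kn
      by (auto simp: path_pairs_def nonneg_path_snoc nonneg_path_append_peak_valley pair_label_def
          successor_def peaks_snoc last_peak_append_peak_valley)
  qed
qed

lemma valley_inject [simp]: "valley a b = valley c d \<longleftrightarrow> a = c \<and> b = d"
proof
  assume "valley a b = valley c d"
  then show "a = c \<and> b = d" by (metis add_left_cancel count_list_valley length_valley)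
qed simp

text \<open>The last step of the new \<open>P\<close> tells whether \<open>b = 0\<close>, and \<open>k\<close> tells where to cut.\<close>

lemma pair_child_inject:
  assumes "(P, Q) \<in> path_pairs n n" "(P', Q') \<in> path_pairs n n"
    "last_peak Q \<le> k" "last_peak Q' \<le> k" "k \<le> n"
    "pair_child n (P, Q) k = pair_child n (P', Q') k"
  shows "P = P' \<and> Q = Q'"
proof (cases "k = n")
  case True
  then show ?thesis using assms by (simp add: pair_child_def)
next
  case False
  then have kn: "k < n" using assms by simp
  obtain w a b where Q: "Q = w @ valley a b" "length w = k" "n = k + a + b"
    using path_pair_split assms kn by blast
  obtain w' a' b' where Q': "Q' = w' @ valley a' b'" "length w' = k" "n = k + a' + b'"
    using path_pair_split assms kn by blast
  show ?thesis
    using assms(6) Q Q' unfolding pair_child_valley[OF Q kn] pair_child_valley[OF Q' kn]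
    by (auto split: if_splits)
qed

text \<open>Unless both paths end in an up-step, the second path has a last peak, whose up-step is the one that was
  inserted. The last step of the first path then says which case of the construction to undo.\<close>

lemma pair_child_surj:
  assumes "(P', Q') \<in> path_pairs (Suc n) (Suc n)"
  shows "\<exists>P Q k. (P, Q) \<in> path_pairs n n \<and> last_peak Q \<le> k \<and> k \<le> n \<and>
    (P', Q') = pair_child n (P, Q) k"
proof -
  obtain P x where P': "P' = P @ [x]" using assms by (cases P' rule: rev_cases) (auto simp: path_pairs_def)
  obtain Q y where Q': "Q' = Q @ [y]" using assms by (cases Q' rule: rev_cases) (auto simp: path_pairs_def)
  have P: "nonneg_path P" "length P = n" "x = 1 \<or> x = -1" "0 \<le> sum_list P + x"
    and Q: "nonneg_path Q" "length Q = n" "y = 1 \<or> y = -1"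
    and eq: "sum_list P + x = sum_list Q + y"
    using assms by (auto simp: P' Q' path_pairs_def nonneg_path_snoc)
  show ?thesis
  proof (cases "x = 1 \<and> y = 1")
    case True
    have "last_peak Q \<le> n" using Q by (auto simp: last_peak_le_iff peaks_def)
    then show ?thesis
      using True P Q eq by (intro exI[of _ P] exI[of _ Q] exI[of _ n])
        (auto simp: pair_child_def path_pairs_def P' Q')
  next
    case False
    have nn: "nonneg_path Q'" using assms by (auto simp: path_pairs_def)
    show ?thesis
      using nn
    proof (cases rule: nonneg_path_cases)
      case ups
      \<comment> \<open>Two paths of the maximal height both end in an up-step.\<close>
      have "sum_list Q' = int (length Q')"
        using ups by (rule sum_list_ups)
      then have "sum_list P + x = int n + 1" using eq Q by (simp add: Q')
      moreover have "last Q' = 1" using arg_cong[OF ups, of last] Q' by (simp add: last_replicate)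
      ultimately have "x = 1 \<and> y = 1" using nonneg_path_sum_le[OF P(1)] P Q' by auto
      then show ?thesis using False by simp
    next
      case (peak w a b)
      have len: "length w + a + b = n" using arg_cong[OF peak(1), of length] Q Q' by simp
      have w: "nonneg_path w" "int a \<le> sum_list w + 1"
        using nn peak(1) by (simp_all add: nonneg_path_append_peak_valley)
      have s: "sum_list P + x = sum_list w + 1 + int b - int a"
        using arg_cong[OF peak(1), of sum_list] eq Q' by simp
      show ?thesis
      proof (cases "x = 1")
        case True
        then have "last Q' = -1" using False Q Q' by auto
        then have b: "b = 0" unfolding peak(1) by (cases b) (auto simp: valley_def split: if_splits)
        have kn: "length w < n" using len peak(2) by simp
        have "(P, w @ valley a 0) \<in> path_pairs n n"
          using P w s True len b nonneg_path_sum_nonneg[OF P(1)] by (auto simp: path_pairs_def nonneg_path_append_valley)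
        moreover have "pair_child n (P, w @ valley a 0) (length w) = (P', Q')"
          using pair_child_valley[of "w @ valley a 0" w a 0 "length w" n P] len b kn True P' peak(1)
          by simp
        ultimately show ?thesis using kn last_peak_append_valley_le[of w a 0]
          by (metis less_imp_le)
      next
        case False
        then have x: "x = -1" using P by simp
        have kn: "length w < n" using len peak(2) by simp
        let ?Q = "w @ valley (a - 1) (b + 1)"
        have "(P, ?Q) \<in> path_pairs n n"
          using P w s x len peak(2) by (auto simp: path_pairs_def nonneg_path_append_valley)
        moreover have "pair_child n (P, ?Q) (length w) = (P', Q')"
          using pair_child_valley[of ?Q w "a - 1" "b + 1" "length w" n P] len kn x P' peak
          by simp
        ultimately show ?thesis using kn last_peak_append_valley_le[of w "a - 1" "b + 1"]
          by (metis less_imp_le)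
      qed
    qed
  qed
qed

lemma sum_path_pairs_eq_tree_sum:
  "(\<Sum>x\<in>path_pairs n n. F (pair_label x)) = tree_sum n F"
proof (rule sum_label_eq_tree_sum[where child = pair_child and label = "\<lambda>_. pair_label"
      and A = "\<lambda>n. path_pairs n n" and r = "([], [])"])
  show "path_pairs 0 0 = {([], [])}" by (auto simp: path_pairs_def)
  show "pair_label ([], []) = ({}, 0, True)" by (simp add: pair_label_def last_peak_def peaks_def)
next
  fix n x k
  assume "x \<in> path_pairs n n" "fst (snd (pair_label x)) \<le> k" "k \<le> n"
  then show "pair_child n x k \<in> path_pairs (Suc n) (Suc n) \<and>
      pair_label (pair_child n x k) = successor n (pair_label x) k"
    using pair_child_correct by (cases x) (auto simp: pair_label_def)
next
  fix n x y k
  assume "x \<in> path_pairs n n" "y \<in> path_pairs n n" "fst (snd (pair_label x)) \<le> k"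
    "fst (snd (pair_label y)) \<le> k" "k \<le> n" "pair_child n x k = pair_child n y k"
  then show "x = y"
    using pair_child_inject by (cases x, cases y) (auto simp: pair_label_def)
next
  fix n z
  assume "z \<in> path_pairs (Suc n) (Suc n)"
  then obtain P Q k where "(P, Q) \<in> path_pairs n n" "last_peak Q \<le> k" "k \<le> n" "z = pair_child n (P, Q) k"
    using pair_child_surj by (cases z) blast
  then show "\<exists>x\<in>path_pairs n n. \<exists>k. fst (snd (pair_label x)) \<le> k \<and> k \<le> n \<and> z = pair_child n x k"
    by (intro bexI[of _ "(P, Q)"] exI[of _ k]) (auto simp: pair_label_def)
qed (rule finite_path_pairs)

section \<open>Growing 321-avoiding permutations\<close>

text \<open>The cycle of positions with the property that \<open>\<pi> \<circ> ins_cycle n k\<close> is the word of \<open>\<pi>\<close> with \<open>n + 1\<close>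
  inserted after the first \<open>k\<close> letters; note that \<open>\<pi> (n + 1) = n + 1\<close> if \<open>\<pi>\<close> permutes \<open>{1..n}\<close>.\<close>

definition ins_cycle :: "nat \<Rightarrow> nat \<Rightarrow> nat \<Rightarrow> nat" where
  "ins_cycle n k i = (if i \<le> k \<or> n + 1 < i then i else if i = k + 1 then n + 1 else i - 1)"

definition ins_cycle_inv :: "nat \<Rightarrow> nat \<Rightarrow> nat \<Rightarrow> nat" where
  "ins_cycle_inv n k j = (if j \<le> k \<or> n + 1 < j then j else if j = n + 1 then k + 1 else j + 1)"

lemma ins_cycle_inverse [simp]:
  assumes "k \<le> n"
  shows "ins_cycle n k (ins_cycle_inv n k j) = j" "ins_cycle_inv n k (ins_cycle n k i) = i"
  using assms by (auto simp: ins_cycle_def ins_cycle_inv_def)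

lemma ins_cycle_permutes:
  assumes "k \<le> n"
  shows "ins_cycle n k permutes {1..n+1}" "ins_cycle_inv n k permutes {1..n+1}"
proof -
  have "bij_betw (ins_cycle n k) {1..n+1} {1..n+1}"
    by (rule bij_betw_byWitness[of _ "ins_cycle_inv n k"])
       (use assms in \<open>auto simp: ins_cycle_def ins_cycle_inv_def\<close>)
  then show "ins_cycle n k permutes {1..n+1}"
    by (rule bij_imp_permutes) (auto simp: ins_cycle_def)
  have "bij_betw (ins_cycle_inv n k) {1..n+1} {1..n+1}"
    by (rule bij_betw_byWitness[of _ "ins_cycle n k"])
       (use assms in \<open>auto simp: ins_cycle_def ins_cycle_inv_def\<close>)
  then show "ins_cycle_inv n k permutes {1..n+1}"
    by (rule bij_imp_permutes) (auto simp: ins_cycle_inv_def)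
qed

lemma inv_comp_ins_cycle:
  assumes "\<pi> permutes S" "k \<le> n"
  shows "inv (\<pi> \<circ> ins_cycle n k) = ins_cycle_inv n k \<circ> inv \<pi>"
proof -
  have "inv (ins_cycle n k) = ins_cycle_inv n k"
    by (rule inv_equality) (use assms in simp_all)
  then show ?thesis
    using o_inv_distrib[OF permutes_bij[OF assms(1)] permutes_bij[OF ins_cycle_permutes(1)[OF assms(2)]]]
    by simp
qed

lemma ins_cycle_inv_less_iff:
  assumes "i \<le> n" "j \<le> n"
  shows "ins_cycle_inv n k i < ins_cycle_inv n k j \<longleftrightarrow> i < j"
  using assms by (auto simp: ins_cycle_inv_def)

text \<open>This reconciles the special treatment of the identity in \<open>perm_ldes\<close> with a maximum over the
  possibly empty set of descents.\<close>

lemma permutes_no_descent_imp_id: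
  assumes "\<pi> permutes {1..n}" "perm_Des n \<pi> = {}"
  shows "\<pi> = id"
proof (rule permutes_natset_ge[OF assms(1)], rule ballI)
  fix i assume "i \<in> {1..n}"
  then have "1 \<le> i" "i \<le> n" by auto
  then show "i \<le> \<pi> i"
  proof (induction i rule: dec_induct)
    case base
    then show ?case using permutes_in_image[OF assms(1), of 1] by simp
  next
    case (step i)
    have "\<not> \<pi> i > \<pi> (i + 1)" using assms(2) step by (auto simp: perm_Des_def)
    moreover have "\<pi> i \<noteq> \<pi> (i + 1)" using permutes_inj[OF assms(1)] by (auto simp: inj_eq)
    ultimately show ?case using step by simp
  qed
qed

lemma perm_ldes_eq:
  assumes "\<pi> permutes {1..n}"
  shows "perm_ldes n \<pi> = Max (insert 0 (perm_Des n \<pi>))"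
proof (cases "\<pi> = id")
  case True
  then have "perm_Des n \<pi> = {}" by (auto simp: perm_Des_def)
  then show ?thesis using True by (simp add: perm_ldes_def)
next
  case False
  then have "perm_Des n \<pi> \<noteq> {}" using permutes_no_descent_imp_id[OF assms] by auto
  moreover have "finite (perm_Des n \<pi>)" by (simp add: perm_Des_def)
  ultimately show ?thesis using False by (simp add: perm_ldes_def)
qed

lemma perm_ldes_le_iff:
  assumes "\<pi> permutes {1..n}"
  shows "perm_ldes n \<pi> \<le> k \<longleftrightarrow> (\<forall>i\<in>perm_Des n \<pi>. i \<le> k)"
  by (simp add: perm_ldes_eq[OF assms] perm_Des_def)

lemma increasing_after_perm_ldes:
  assumes "\<pi> permutes {1..n}" "perm_ldes n \<pi> \<le> k" "k < i" "i < j" "j \<le> n"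
  shows "\<pi> i < \<pi> j"
proof -
  have step: "\<pi> m < \<pi> (Suc m)" if "k < m" "m < n" for m
  proof -
    have "m \<notin> perm_Des n \<pi>" using assms that by (auto simp: perm_ldes_le_iff)
    then have "\<not> \<pi> m > \<pi> (Suc m)" using that by (auto simp: perm_Des_def)
    moreover have "\<pi> m \<noteq> \<pi> (Suc m)" using permutes_inj[OF assms(1)] by (auto simp: inj_eq)
    ultimately show ?thesis by simp
  qed
  from \<open>i < j\<close> have "Suc i \<le> j" by simp
  then show ?thesis using \<open>j \<le> n\<close>
  proof (induction j rule: dec_induct)
    case base
    then show ?case using step[of i] assms by simp
  next
    case (step m)
    then show ?case using \<open>\<And>m. k < m \<Longrightarrow> m < n \<Longrightarrow> \<pi> m < \<pi> (Suc m)\<close>[of m] assms by simp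
  qed
qed

definition perm_label :: "nat \<Rightarrow> (nat \<Rightarrow> nat) \<Rightarrow> label" where
  "perm_label n \<pi> = (perm_Des n (inv \<pi>), perm_ldes n \<pi>, \<pi> n = n)"

text \<open>A new 321 pattern would have to start with the new maximum, but the entries behind it increase.\<close>

lemma insert_max_in_T:
  assumes "\<pi> \<in> T n" "perm_ldes n \<pi> \<le> k" "k \<le> n"
  shows "\<pi> \<circ> ins_cycle n k \<in> T (Suc n)"
proof -
  have p: "\<pi> permutes {1..n}" and av: "avoids_321 n \<pi>" using assms by (auto simp: T_def)
  have p': "\<pi> permutes {1..n+1}" by (rule permutes_subset[OF p]) auto
  have s: "\<pi> \<circ> ins_cycle n k permutes {1..n+1}"
    using permutes_compose[OF ins_cycle_permutes(1)[OF assms(3)] p'] .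
  have False
    if "i \<in> {1..n+1}" "j \<in> {1..n+1}" "m \<in> {1..n+1}" "i < j" "j < m"
      "\<pi> (ins_cycle n k i) > \<pi> (ins_cycle n k j)" "\<pi> (ins_cycle n k j) > \<pi> (ins_cycle n k m)"
    for i j m
  proof -
    let ?c = "ins_cycle n k"
    have top: "\<pi> (?c (k + 1)) = n + 1"
      using permutes_not_in[OF p, of "n + 1"] assms(3) by (simp add: ins_cycle_def)
    have le: "\<pi> (?c x) \<le> n + 1" if "x \<in> {1..n+1}" for x
      using permutes_in_image[OF s, of x] that by simp
    have "j \<noteq> k + 1" "m \<noteq> k + 1" using le[of i] le[of j] that top by auto
    consider "i = k + 1" | "i \<noteq> k + 1" by blast
    then show False
    proof cases
      case 1
      then have "?c j = j - 1" "?c m = m - 1" using that by (auto simp: ins_cycle_def)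
      moreover have "\<pi> (j - 1) < \<pi> (m - 1)"
        by (rule increasing_after_perm_ldes[OF p assms(2)]) (use 1 that in auto)
      ultimately show False using that by simp
    next
      case 2
      have "?c i < ?c j" "?c j < ?c m" "?c i \<in> {1..n}" "?c j \<in> {1..n}" "?c m \<in> {1..n}"
        using 2 \<open>j \<noteq> k + 1\<close> \<open>m \<noteq> k + 1\<close> that assms(3) by (auto simp: ins_cycle_def)
      then show False using av that(6,7) by (auto simp: avoids_321_def)
    qed
  qed
  then have "avoids_321 (n + 1) (\<pi> \<circ> ins_cycle n k)"
    unfolding avoids_321_def comp_def by blast
  then show ?thesis using s by (simp add: T_def)
qed

lemma perm_ldes_insert_max:
  assumes "\<pi> \<in> T n" "perm_ldes n \<pi> \<le> k" "k \<le> n"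
  shows "perm_ldes (Suc n) (\<pi> \<circ> ins_cycle n k) = (if k = n then perm_ldes n \<pi> else k + 1)"
proof -
  have p: "\<pi> permutes {1..n}" using assms by (auto simp: T_def)
  have s: "\<pi> \<circ> ins_cycle n k permutes {1..Suc n}"
    using insert_max_in_T[OF assms] by (simp add: T_def)
  have top: "\<pi> (Suc n) = Suc n" using permutes_not_in[OF p] by simp
  have le: "\<pi> i \<le> n" if "1 \<le> i" "i \<le> n" for i using permutes_in_image[OF p, of i] that by simp
  show ?thesis
  proof (cases "k = n")
    case True
    have "ins_cycle n n = id" by (auto simp: ins_cycle_def fun_eq_iff)
    then have "\<pi> \<circ> ins_cycle n k = \<pi>" using True by simp
    moreover have "i \<in> perm_Des (Suc n) \<pi> \<longleftrightarrow> i \<in> perm_Des n \<pi>" for i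
      using top le[of n] by (cases "i = n") (auto simp: perm_Des_def)
    ultimately have "perm_Des (Suc n) (\<pi> \<circ> ins_cycle n k) = perm_Des n \<pi>" by auto
    then show ?thesis using True using perm_ldes_eq[OF s] by (simp add: perm_ldes_eq[OF p])
  next
    case False
    then have kn: "k < n" using assms by simp
    have "k + 1 \<in> perm_Des (Suc n) (\<pi> \<circ> ins_cycle n k)"
      using kn top le[of "k + 1"] by (auto simp: perm_Des_def ins_cycle_def)
    moreover have "i \<le> k + 1" if "i \<in> perm_Des (Suc n) (\<pi> \<circ> ins_cycle n k)" for i
    proof (rule ccontr)
      assume "\<not> i \<le> k + 1"
      then have "k < i - 1" "i \<le> n" "\<pi> (i - 1) > \<pi> i"
        using that by (auto simp: perm_Des_def ins_cycle_def)
      then show False using increasing_after_perm_ldes[OF p assms(2), of "i - 1" i] by simp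
    qed
    ultimately have "Max (insert 0 (perm_Des (Suc n) (\<pi> \<circ> ins_cycle n k))) = k + 1"
      by (intro Max_eqI) (auto simp: perm_Des_def)
    then show ?thesis using False by (simp add: perm_ldes_eq[OF s])
  qed
qed

text \<open>The new inverse descent \<open>n\<close> arises exactly if \<open>n + 1\<close> is inserted in front of \<open>n\<close>. If \<open>n\<close> is not the
  last letter of \<open>\<pi>\<close>, then its position is a descent, hence at most \<open>k\<close>, and \<open>n + 1\<close> comes after it.\<close>

lemma perm_inv_Des_insert_max:
  assumes "\<pi> \<in> T n" "perm_ldes n \<pi> \<le> k" "k \<le> n"
  shows "perm_Des (Suc n) (inv (\<pi> \<circ> ins_cycle n k)) =
    (if \<pi> n = n \<and> k < n then insert n (perm_Des n (inv \<pi>)) else perm_Des n (inv \<pi>))"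
proof -
  have p: "\<pi> permutes {1..n}" using assms by (auto simp: T_def)
  note q = permutes_inv[OF p]
  have inv: "inv (\<pi> \<circ> ins_cycle n k) = ins_cycle_inv n k \<circ> inv \<pi>"
    using inv_comp_ins_cycle[OF p assms(3)] .
  have le: "1 \<le> inv \<pi> i \<and> inv \<pi> i \<le> n" if "1 \<le> i" "i \<le> n" for i
    using permutes_in_image[OF q, of i] that by simp
  have top: "inv \<pi> (Suc n) = Suc n" using permutes_not_in[OF q] by simp
  have small: "i \<in> perm_Des (Suc n) (inv (\<pi> \<circ> ins_cycle n k)) \<longleftrightarrow> i \<in> perm_Des n (inv \<pi>)"
    if "i \<noteq> n" for i
    using that le[of i] le[of "i + 1"] ins_cycle_inv_less_iff[of "inv \<pi> (i + 1)" n "inv \<pi> i" k]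
    unfolding inv perm_Des_def by auto
  have last: "n \<in> perm_Des (Suc n) (inv (\<pi> \<circ> ins_cycle n k)) \<longleftrightarrow> \<pi> n = n \<and> k < n"
  proof (cases "n = 0")
    case True
    then show ?thesis by (simp add: perm_Des_def)
  next
    case False
    let ?m = "inv \<pi> n"
    have m: "1 \<le> ?m" "?m \<le> n" using le[of n] False by auto
    have pm: "\<pi> ?m = n" using permutes_inverses(1)[OF p] .
    have "n \<in> perm_Des (Suc n) (inv (\<pi> \<circ> ins_cycle n k)) \<longleftrightarrow> k < ?m"
      using False top m assms(3) unfolding inv perm_Des_def by (auto simp: ins_cycle_inv_def)
    also have "\<dots> \<longleftrightarrow> \<pi> n = n \<and> k < n"
    proof (cases "?m = n")
      case True
      then show ?thesis using pm by simp
    next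
      case neq: False
      \<comment> \<open>The value \<open>n\<close> stands in front of something smaller, hence at a descent.\<close>
      then have mn: "?m < n" using m by simp
      have "\<pi> (?m + 1) \<in> {1..n}" using permutes_in_image[OF p, of "?m + 1"] mn by simp
      moreover have "\<pi> (?m + 1) \<noteq> \<pi> ?m" using permutes_inj[OF p] by (auto simp: inj_eq)
      ultimately have "?m \<in> perm_Des n \<pi>" using pm m mn by (auto simp: perm_Des_def)
      then have "?m \<le> k" using assms(2) perm_ldes_le_iff[OF p] by blast
      moreover have "\<pi> n \<noteq> n" using neq permutes_inverses(2)[OF p, of n] by auto
      ultimately show ?thesis by simp
    qed
    finally show ?thesis .
  qed
  have old: "n \<notin> perm_Des n (inv \<pi>)" by (auto simp: perm_Des_def)
  show ?thesis
  proof (rule set_eqI)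
    fix i show "i \<in> perm_Des (Suc n) (inv (\<pi> \<circ> ins_cycle n k)) \<longleftrightarrow>
        i \<in> (if \<pi> n = n \<and> k < n then insert n (perm_Des n (inv \<pi>)) else perm_Des n (inv \<pi>))"
      using small[of i] last old by (cases "i = n") auto
  qed
qed

lemma perm_label_insert_max:
  assumes "\<pi> \<in> T n" "perm_ldes n \<pi> \<le> k" "k \<le> n"
  shows "perm_label (Suc n) (\<pi> \<circ> ins_cycle n k) = successor n (perm_label n \<pi>) k"
proof -
  have p: "\<pi> permutes {1..n}" using assms by (auto simp: T_def)
  have "(\<pi> \<circ> ins_cycle n k) (Suc n) = Suc n \<longleftrightarrow> k = n"
    using permutes_not_in[OF p, of "Suc n"] permutes_in_image[OF p, of n] assms(3)
    by (auto simp: ins_cycle_def)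
  then show ?thesis
    by (simp add: perm_label_def successor_def perm_inv_Des_insert_max[OF assms]
        perm_ldes_insert_max[OF assms])
qed

lemma delete_max:
  assumes "\<sigma> \<in> T (Suc n)"
  shows "\<exists>\<pi>\<in>T n. \<exists>k. perm_ldes n \<pi> \<le> k \<and> k \<le> n \<and> \<sigma> = \<pi> \<circ> ins_cycle n k"
proof -
  have s: "\<sigma> permutes {1..n+1}" and av: "avoids_321 (Suc n) \<sigma>" using assms by (auto simp: T_def)
  define k where "k = inv \<sigma> (n + 1) - 1"
  have "inv \<sigma> (n + 1) \<in> {1..n+1}" using permutes_in_image[OF permutes_inv[OF s], of "n + 1"] by simp
  then have k: "inv \<sigma> (n + 1) = k + 1" "k \<le> n" by (auto simp: k_def)
  then have top: "\<sigma> (k + 1) = n + 1" using permutes_inverses(1)[OF s, of "n + 1"] by simp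
  define \<pi> where "\<pi> = \<sigma> \<circ> ins_cycle_inv n k"
  have "\<pi> permutes {1..n+1}"
    unfolding \<pi>_def by (rule permutes_compose[OF ins_cycle_permutes(2)[OF k(2)] s])
  moreover have "\<pi> (n + 1) = n + 1" using top k by (simp add: \<pi>_def ins_cycle_inv_def)
  ultimately have p: "\<pi> permutes {1..n}" by (elim permutes_superset) (auto simp: le_Suc_eq)
  have "avoids_321 n \<pi>"
    unfolding avoids_321_def
  proof clarify
    fix i j m assume h: "i \<in> {1..n}" "j \<in> {1..n}" "m \<in> {1..n}" "i < j" "j < m" "\<pi> j < \<pi> i" "\<pi> m < \<pi> j"
    let ?d = "ins_cycle_inv n k"
    have "?d i \<in> {1..Suc n}" "?d j \<in> {1..Suc n}" "?d m \<in> {1..Suc n}" "?d i < ?d j" "?d j < ?d m"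
      using h by (auto simp: ins_cycle_inv_def)
    then show False using av h(6,7) by (auto simp: avoids_321_def \<pi>_def)
  qed
  then have "\<pi> \<in> T n" using p by (simp add: T_def)
  moreover have "perm_ldes n \<pi> \<le> k"
    unfolding perm_ldes_le_iff[OF p]
  proof (rule ballI, rule ccontr)
    fix i assume i: "i \<in> perm_Des n \<pi>" "\<not> i \<le> k"
    \<comment> \<open>A descent behind the position of the maximum would complete a 321 pattern.\<close>
    then have i': "1 \<le> i" "i + 1 \<le> n" "\<pi> i > \<pi> (i + 1)"
      by (auto simp: perm_Des_def)
    then have h: "1 \<le> i" "i + 1 \<le> n" "\<sigma> (i + 1) > \<sigma> (i + 2)"
      using i(2) by (auto simp: \<pi>_def ins_cycle_inv_def)
    have "\<sigma> (i + 1) \<noteq> \<sigma> (k + 1)" using permutes_inj[OF s] i by (auto simp: inj_eq)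
    moreover have "\<sigma> (i + 1) \<le> n + 1" using permutes_in_image[OF s, of "i + 1"] h by simp
    ultimately have "\<sigma> (k + 1) > \<sigma> (i + 1)" using top by simp
    moreover have "k + 1 \<in> {1..Suc n}" "i + 1 \<in> {1..Suc n}" "i + 2 \<in> {1..Suc n}"
      "k + 1 < i + 1" "i + 1 < i + 2" using i h by auto
    ultimately show False using av h(3) unfolding avoids_321_def by blast
  qed
  moreover have "\<sigma> = \<pi> \<circ> ins_cycle n k" using k by (auto simp: \<pi>_def)
  ultimately show ?thesis using k by blast
qed

lemma sum_T_eq_tree_sum:
  "(\<Sum>\<pi>\<in>T n. F (perm_label n \<pi>)) = tree_sum n F"
proof (rule sum_label_eq_tree_sum[where child = "\<lambda>n \<pi> k. \<pi> \<circ> ins_cycle n k" and r = id])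
  show "finite (T n)" for n
    by (rule finite_subset[OF _ finite_permutations[of "{1..n}"]]) (auto simp: T_def)
  show "T 0 = {id}" by (auto simp: T_def avoids_321_def)
  show "perm_label 0 id = ({}, 0, True)" by (simp add: perm_label_def perm_Des_def perm_ldes_def)
next
  fix n \<pi> k assume "\<pi> \<in> T n" "fst (snd (perm_label n \<pi>)) \<le> k" "k \<le> n"
  then show "\<pi> \<circ> ins_cycle n k \<in> T (Suc n) \<and>
      perm_label (Suc n) (\<pi> \<circ> ins_cycle n k) = successor n (perm_label n \<pi>) k"
    using insert_max_in_T perm_label_insert_max by (simp add: perm_label_def)
next
  fix n k and \<pi> \<pi>' :: "nat \<Rightarrow> nat"
  assume kn: "k \<le> n" and eq: "\<pi> \<circ> ins_cycle n k = \<pi>' \<circ> ins_cycle n k"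
  have "\<pi> j = \<pi>' j" for j using fun_cong[OF eq, of "ins_cycle_inv n k j"] kn by simp
  then show "\<pi> = \<pi>'" by blast
next
  fix n \<sigma> assume "\<sigma> \<in> T (Suc n)"
  then show "\<exists>\<pi>\<in>T n. \<exists>k. fst (snd (perm_label n \<pi>)) \<le> k \<and> k \<le> n \<and> \<sigma> = \<pi> \<circ> ins_cycle n k"
    using delete_max by (simp add: perm_label_def)
qed

section \<open>Shifting the last peak\<close>

text \<open>Without its last step \<open>x\<close>, the path \<open>u\<close> is \<open>w\<close> followed by an up-step and \<open>valley a b\<close>. Moving \<open>x\<close> in
  front of this up-step moves the last peak by one. This fails if \<open>x\<close> is a down-step and the valley
  touches height 0; such paths are sent to those that the first rule does not reach, namely the paths with an
  up-step in front of the last peak and a valley that touches 0. If \<open>l = 0\<close>, then \<open>u\<close> rises to its last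
  step, a down-step, and the image has its last peak at 1.\<close>

definition lift_last_peak :: "int list \<Rightarrow> int list" where
  "lift_last_peak u =
    (let v = butlast u; x = last u; l = last_peak v; w = take (l - 1) v;
         a = count_list (drop l v) (-1); b = length v - l - a
     in if l = 0 then 1 # valley 1 (length v - 1)
        else if x = 1 \<or> int a \<le> sum_list w then w @ x # 1 # valley a b
        else w @ 1 # 1 # valley (a + 1) (b - 1))"

lemma lift_last_peak_ups:
  "lift_last_peak (replicate n 1 @ [x]) = 1 # valley 1 (n - 1)"
  by (simp add: lift_last_peak_def)

lemma lift_last_peak_peak:
  assumes "0 < a"
  shows "lift_last_peak ((w @ 1 # valley a b) @ [x]) =
    (if x = 1 \<or> int a \<le> sum_list w then w @ x # 1 # valley a b
     else w @ 1 # 1 # valley (a + 1) (b - 1))"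
  using assms unfolding lift_last_peak_def Let_def butlast_snoc last_snoc
  by (simp add: last_peak_append_peak_valley)

text \<open>The normal form by the last step and the last peak before it. The path of up-steps only
  is excluded: it has no peak that could be moved.\<close>

lemma snoc_path_cases [consumes 2, case_names ups peak]:
  assumes "nonneg_path u" "sum_list u < int (length u)"
  obtains "u = replicate (length u - 1) 1 @ [-1]" "2 \<le> length u" "last_peak (butlast u) = 0"
    | w a b x where "u = (w @ 1 # valley a b) @ [x]" "0 < a" "length w = last_peak (butlast u) - 1"
       "last_peak (butlast u) \<noteq> 0"
       "nonneg_path w" "int a \<le> sum_list w + 1" "x = 1 \<or> x = -1 \<and> (int a \<le> sum_list w \<or> 0 < b)"
proof -
  have "u \<noteq> []" using assms by auto
  then obtain v x where u: "u = v @ [x]" by (metis rev_exhaust)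
  have v: "nonneg_path v" "x = 1 \<or> x = -1" "0 \<le> sum_list v + x"
    using assms by (auto simp: u nonneg_path_snoc)
  from v(1) show ?thesis
  proof (cases rule: nonneg_path_cases)
    case ups
    then have "sum_list v = int (length v)" by (rule sum_list_ups)
    then have x: "x = -1" "1 \<le> length v" using assms v by (auto simp: u Suc_le_eq)
    have "last_peak v = 0" by (subst ups) simp
    then show ?thesis using x ups that(1) by (simp add: u)
  next
    case (peak w a b)
    have "nonneg_path w" "int a \<le> sum_list w + 1"
      using v peak(1) by (simp_all add: nonneg_path_append_peak_valley)
    moreover have "x = 1 \<or> x = -1 \<and> (int a \<le> sum_list w \<or> 0 < b)"
      using v peak(1) by auto
    moreover have "last_peak v \<noteq> 0"
      using last_peak_append_peak_valley[OF peak(2)] peak(1) by simp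
    moreover have "butlast u = v" using u by simp
    moreover have "u = (w @ 1 # valley a b) @ [x]" using u peak(1) by simp
    ultimately show ?thesis using that(2)[of w a b x] peak(2,3) by simp
  qed
qed

lemma lift_last_peak_correct:
  assumes "nonneg_path u" "sum_list u < int (length u)"
  shows "nonneg_path (lift_last_peak u) \<and> length (lift_last_peak u) = length u \<and>
    sum_list (lift_last_peak u) = sum_list u \<and>
    last_peak (lift_last_peak u) = Suc (last_peak (butlast u))"
  using assms
proof (cases rule: snoc_path_cases)
  case ups
  obtain n where n: "length u = n + 2" using ups(2) by (metis add.commute le_Suc_ex)
  then have u: "u = replicate (n + 1) 1 @ [-1]" using ups(1) by simp
  have "lift_last_peak u = [] @ 1 # valley 1 n"
    by (subst u) (simp only: lift_last_peak_ups, simp)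
  moreover have "sum_list u = int n" by (subst u) (simp add: sum_list_replicate)
  ultimately show ?thesis
    using n ups(3) last_peak_append_peak_valley[of 1 "[]" n] nonneg_path_append_peak_valley[of "[]" 1 n]
    by simp
next
  case (peak w a b x)
  have l: "last_peak (butlast u) = Suc (length w)" using peak by simp
  consider "x = 1 \<or> int a \<le> sum_list w" | "x = -1" "\<not> int a \<le> sum_list w" "0 < b"
    using peak by auto
  then show ?thesis
  proof cases
    case 1
    then have "lift_last_peak u = (w @ [x]) @ 1 # valley a b"
      using peak by (simp only: lift_last_peak_peak) simp
    moreover have "nonneg_path ((w @ [x]) @ 1 # valley a b)"
      unfolding nonneg_path_append_peak_valley nonneg_path_snoc using peak 1 by auto
    ultimately show ?thesis
      using last_peak_append_peak_valley[OF peak(2), of "w @ [x]" b] l peak(1) by simp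
  next
    case 2
    then have "lift_last_peak u = (w @ [1]) @ 1 # valley (a + 1) (b - 1)"
      using peak by (simp only: lift_last_peak_peak) simp
    moreover have "nonneg_path ((w @ [1]) @ 1 # valley (a + 1) (b - 1))"
      unfolding nonneg_path_append_peak_valley nonneg_path_snoc
      using peak 2 nonneg_path_sum_nonneg[of w] by auto
    ultimately show ?thesis
      using last_peak_append_peak_valley[of "a + 1" "w @ [1]" "b - 1"] l peak(1) 2 by simp
  qed
qed

lemma lift_last_peak_inject:
  assumes u: "nonneg_path u" "sum_list u < int (length u)"
    and u': "nonneg_path u'" "sum_list u' < int (length u')"
    and eq: "lift_last_peak u = lift_last_peak u'"
  shows "u = u'"
proof -
  have len: "length u = length u'" and lp: "last_peak (butlast u) = last_peak (butlast u')"
    using lift_last_peak_correct[OF u] lift_last_peak_correct[OF u'] eq by auto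
  from u show ?thesis
  proof (cases rule: snoc_path_cases)
    case ups
    note 1 = ups
    from u' show ?thesis
    proof (cases rule: snoc_path_cases)
      case ups
      then show ?thesis using 1 len by metis
    next
      case (peak w a b x)
      then show ?thesis using 1 lp by simp
    qed
  next
    case (peak w a b x)
    note 1 = peak
    from u' show ?thesis
    proof (cases rule: snoc_path_cases)
      case ups
      then show ?thesis using 1 lp by simp
    next
      case (peak w' a' b' x')
      have "length w = length w'" using 1 peak lp by simp
      then show ?thesis
        using eq 1 peak unfolding 1(1) peak(1) lift_last_peak_peak[OF 1(2)] lift_last_peak_peak[OF peak(2)]
        by (auto split: if_splits)
    qed
  qed
qed

text \<open>Lengths and final heights are preserved, so \<open>lift_last_peak\<close> maps a finite set injectively into itself
  and permutes it. The paths of length \<open>n + 1\<close> in question end at height at most \<open>n - 1\<close>, because their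
  partners have \<open>n - 1\<close> steps.\<close>

lemma sum_last_peak_lift:
  fixes F :: "nat set \<times> nat \<Rightarrow> 'b::comm_monoid_add"
  assumes "1 \<le> n"
  shows "(\<Sum>(P, Q)\<in>path_pairs (n - 1) (n + 1). F (peaks P, last_peak (take n Q))) =
    (\<Sum>(P, Q)\<in>path_pairs (n - 1) (n + 1). F (peaks P, last_peak Q - 1))"
proof -
  define E where "E = path_pairs (n - 1) (n + 1)"
  define f where "f = (\<lambda>(P :: int list, Q). (P, lift_last_peak Q))"
  have low: "nonneg_path Q" "sum_list Q < int (length Q)" "take n Q = butlast Q" if "(P, Q) \<in> E" for P Q
    using that assms nonneg_path_sum_le[of P] by (auto simp: E_def path_pairs_def butlast_conv_take)
  have "f ` E \<subseteq> E"
  proof (rule image_subsetI, clarify)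
    fix P Q assume pq: "(P, Q) \<in> E"
    show "f (P, Q) \<in> E"
      using pq lift_last_peak_correct[OF low(1,2)[OF pq]] by (auto simp: E_def path_pairs_def f_def)
  qed
  moreover have inj: "inj_on f E"
    using lift_last_peak_inject low by (auto simp: inj_on_def f_def)
  ultimately have "f ` E = E" by (intro endo_inj_surj) (auto simp: E_def finite_path_pairs)
  then have "bij_betw f E E" using inj by (simp add: bij_betw_def)
  from sum.reindex_bij_betw[OF this, of "\<lambda>(P, Q). F (peaks P, last_peak Q - 1)"]
  have "(\<Sum>(P, Q)\<in>E. F (peaks P, last_peak Q - 1)) =
      (\<Sum>x\<in>E. case f x of (P, Q) \<Rightarrow> F (peaks P, last_peak Q - 1))" by simp
  also have "\<dots> = (\<Sum>(P, Q)\<in>E. F (peaks P, last_peak (take n Q)))"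
    using lift_last_peak_correct low by (intro sum.cong) (auto simp: f_def)
  finally show ?thesis by (simp add: E_def)
qed

lemma sum_ldes_eq_sum_lind:
  fixes F :: "nat set \<times> nat \<Rightarrow> 'b::comm_monoid_add"
  assumes "1 \<le> n"
  shows "(\<Sum>p\<in>dyck_paths n. F (path_inv_Des n p \<inter> {1..n-2}, path_ldes n p)) =
    (\<Sum>p\<in>dyck_paths n. F (path_inv_Des n p \<inter> {1..n-2}, path_lind n p - 1))"
proof -
  have ab: "(n - 1) + (n + 1) = 2 * n" using assms by simp
  note bij = bij_betw_glue[OF ab]
  have D: "path_inv_Des n (glue (P, Q)) \<inter> {1..n-2} = peaks P"
    if "(P, Q) \<in> path_pairs (n - 1) (n + 1)" for P Q
    using path_inv_Des_glue[OF ab _ that] by (simp add: numeral_2_eq_2)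
  have "(\<Sum>p\<in>dyck_paths n. F (path_inv_Des n p \<inter> {1..n-2}, path_ldes n p)) =
      (\<Sum>(P, Q)\<in>path_pairs (n - 1) (n + 1). F (peaks P, last_peak (take n Q)))"
    unfolding sum.reindex_bij_betw[OF bij, symmetric]
    using D path_ldes_glue[OF _ ab] by (intro sum.cong) auto
  also have "\<dots> = (\<Sum>(P, Q)\<in>path_pairs (n - 1) (n + 1). F (peaks P, last_peak Q - 1))"
    by (rule sum_last_peak_lift[OF assms])
  also have "\<dots> = (\<Sum>p\<in>dyck_paths n. F (path_inv_Des n p \<inter> {1..n-2}, path_lind n p - 1))"
    unfolding sum.reindex_bij_betw[OF bij, symmetric]
    using D path_lind_glue[OF _ assms] by (intro sum.cong) auto
  finally show ?thesis .
qed

section \<open>Equidistribution\<close>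

lemma sum_T_eq_sum_dyck_paths:
  fixes F :: "nat set \<times> nat \<Rightarrow> 'b::comm_monoid_add"
  shows "(\<Sum>\<pi>\<in>T n. F (perm_Des n (inv \<pi>), perm_ldes n \<pi>)) =
    (\<Sum>p\<in>dyck_paths n. F (path_inv_Des n p, path_ldes n p))"
proof -
  let ?F = "\<lambda>(D, l, e). F (D, l)"
  have nn: "n + n = 2 * n" by simp
  have D: "path_inv_Des n (glue (P, Q)) = peaks P \<and> path_ldes n (glue (P, Q)) = last_peak Q"
    if "(P, Q) \<in> path_pairs n n" for P Q
  proof -
    have "path_inv_Des n (glue (P, Q)) \<subseteq> {1..n-1}" unfolding path_inv_Des_def by blast
    then show ?thesis
      using path_inv_Des_glue[OF nn order_refl that] path_ldes_glue[OF order_refl nn that] that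
      by (simp only: Int_absorb2) (simp add: path_pairs_def)
  qed
  have "(\<Sum>\<pi>\<in>T n. F (perm_Des n (inv \<pi>), perm_ldes n \<pi>)) = (\<Sum>\<pi>\<in>T n. ?F (perm_label n \<pi>))"
    by (simp add: perm_label_def)
  also have "\<dots> = (\<Sum>x\<in>path_pairs n n. ?F (pair_label x))"
    by (simp only: sum_T_eq_tree_sum sum_path_pairs_eq_tree_sum)
  also have "\<dots> = (\<Sum>p\<in>dyck_paths n. F (path_inv_Des n p, path_ldes n p))"
    unfolding sum.reindex_bij_betw[OF bij_betw_glue[OF nn], symmetric]
    using D by (intro sum.cong) (auto simp: pair_label_def)
  finally show ?thesis .
qed

theorem theorem1p2:
  fixes n :: nat
  assumes "n \<ge> 1"
  shows "((\<Sum>\<pi>\<in>T n. q ^ perm_ldes n \<pi>) = (\<Sum>p\<in>dyck_paths n. q ^ path_ldes n p) \<and>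
          (\<Sum>p\<in>dyck_paths n. q ^ path_ldes n p) = (\<Sum>p\<in>dyck_paths n. q ^ (path_lind n p - 1))) \<and>
         (\<forall>B. B \<subseteq> {1..n-2} \<longrightarrow>
           (\<Sum>\<pi>\<in>T_B n B. q ^ perm_ldes n \<pi>) = (\<Sum>p\<in>dyck_paths_B n B. q ^ path_ldes n p) \<and>
           (\<Sum>p\<in>dyck_paths_B n B. q ^ path_ldes n p)
             = (\<Sum>p\<in>dyck_paths_B n B. q ^ (path_lind n p - 1)))"
proof (intro conjI allI impI)
  show "(\<Sum>\<pi>\<in>T n. q ^ perm_ldes n \<pi>) = (\<Sum>p\<in>dyck_paths n. q ^ path_ldes n p)"
    using sum_T_eq_sum_dyck_paths[of "\<lambda>(D, l). q ^ l" n] by simp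
  show "(\<Sum>p\<in>dyck_paths n. q ^ path_ldes n p) = (\<Sum>p\<in>dyck_paths n. q ^ (path_lind n p - 1))"
    using sum_ldes_eq_sum_lind[OF assms, of "\<lambda>(D, l). q ^ l"] by simp
next
  fix B
  have finT: "finite (T n)"
    by (rule finite_subset[OF _ finite_permutations[of "{1..n}"]]) (auto simp: T_def)
  have finP: "finite (dyck_paths n)"
    using bij_betw_finite[OF bij_betw_glue[of n n n]] finite_path_pairs by auto
  have T: "(\<Sum>\<pi>\<in>T_B n B. q ^ perm_ldes n \<pi>) =
      (\<Sum>\<pi>\<in>T n. if perm_Des n (inv \<pi>) \<inter> {1..n-2} = B then q ^ perm_ldes n \<pi> else 0)"
    unfolding T_B_def by (rule sum.inter_filter[OF finT])
  have P: "(\<Sum>p\<in>dyck_paths_B n B. g p) =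
      (\<Sum>p\<in>dyck_paths n. if path_inv_Des n p \<inter> {1..n-2} = B then g p else 0)"
    for g :: "int list \<Rightarrow> int poly"
    unfolding dyck_paths_B_def by (rule sum.inter_filter[OF finP])
  show "(\<Sum>\<pi>\<in>T_B n B. q ^ perm_ldes n \<pi>) = (\<Sum>p\<in>dyck_paths_B n B. q ^ path_ldes n p)"
    using sum_T_eq_sum_dyck_paths[of "\<lambda>(D, l). if D \<inter> {1..n-2} = B then q ^ l else 0" n]
    by (simp add: T P)
  show "(\<Sum>p\<in>dyck_paths_B n B. q ^ path_ldes n p)
      = (\<Sum>p\<in>dyck_paths_B n B. q ^ (path_lind n p - 1))"
    using sum_ldes_eq_sum_lind[OF assms, of "\<lambda>(D, l). if D = B then q ^ l else 0"]
    by (simp add: P)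
qed

end
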